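(* For every integer $n\geq 7$, $b_2(G_{4,n})=1$ if $n\equiv 3\pmod 4$, and $b_2(G_{4,n})=2$ otherwise.
   Context: For a graph $G$, a set $D\subseteq V(G)$ is a $2$-dominating set if every vertex not in $D$ has at least $2$ neighbours in $D$. The $2$-domination number $\gamma_2(G)$ is the minimum cardinality of a $2$-dominating set of $G$. The $2$-bondage number $b_2(G)$ is the minimum cardinality of an edge set $B\subseteq E(G)$ such that $\gamma_2(G-B)>\gamma_2(G)$, where $G-B$ has vertex set $V(G)$ and edge set $E(G)\setminus B$. The grid graph $G_{m,n}=P_m\times P_n$ has vertex set $[m]\times[n]$ (where $[k]=\{1,\dots,k\}$), with $(i,j)$ and $(i',j')$ adjacent iff $|i-i'|+|j-j'|=1$. *)

theory Defs
  imports Main "HOL-Library.Extended_Nat"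
begin

text \<open>An undirected graph has a vertex set and a set of edges, an edge being the
  two-element set of its end vertices.\<close>

record 'a ugraph =
  verts :: "'a set"
  edges :: "'a set set"

definition neighbours :: "'a ugraph \<Rightarrow> 'a \<Rightarrow> 'a set" where
  "neighbours G v = {u \<in> verts G. {u, v} \<in> edges G}"

definition delete_edges :: "'a ugraph \<Rightarrow> 'a set set \<Rightarrow> 'a ugraph" where
  "delete_edges G B = \<lparr>verts = verts G, edges = edges G - B\<rparr>"

definition two_dominating :: "'a ugraph \<Rightarrow> 'a set \<Rightarrow> bool" where
  "two_dominating G D \<longleftrightarrow>
     D \<subseteq> verts G \<and> (\<forall>v \<in> verts G - D. 2 \<le> card (neighbours G v \<inter> D))"

text \<open>Meant for finite graphs, because of the cardinalities taken here and above. The infimum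
  is then a minimum, as the whole vertex set is two-dominating.\<close>

definition two_domination_number :: "'a ugraph \<Rightarrow> nat" where
  "two_domination_number G = (INF D \<in> {D. two_dominating G D}. card D)"

text \<open>The value lies in \<^typ>\<open>enat\<close>, so it is infinite if no edge set raises the two-domination
  number; any finite value is attained by some edge set.\<close>

definition two_bondage_number :: "'a ugraph \<Rightarrow> enat" where
  "two_bondage_number G =
     (INF B \<in> {B. B \<subseteq> edges G \<and>
                  two_domination_number (delete_edges G B) > two_domination_number G}.
        enat (card B))"

definition grid_adjacent :: "nat \<times> nat \<Rightarrow> nat \<times> nat \<Rightarrow> bool" where
  "grid_adjacent p q \<longleftrightarrow>
     \<bar>int (fst p) - int (fst q)\<bar> + \<bar>int (snd p) - int (snd q)\<bar> = 1"

definition grid_graph :: "nat \<Rightarrow> nat \<Rightarrow> (nat \<times> nat) ugraph" where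
  "grid_graph m n =
     \<lparr>verts = {1..m} \<times> {1..n},
      edges = {{p, q} | p q. p \<in> {1..m} \<times> {1..n} \<and> q \<in> {1..m} \<times> {1..n} \<and> grid_adjacent p q}\<rparr>"

end

theory Submission
  imports Defs
begin

text \<open>Every two-dominating set has at least \<open>\<gamma> = \<lfloor>(7 n + 6) / 4\<rfloor>\<close> elements. Reading it column by column,
  a potential on the local state satisfies \<open>potential \<le> 4 * (weight of the next column) - 7 + new
  potential\<close>, so the columns beyond any given one have total weight about \<open>7 / 4\<close> each. Applying this in
  both directions from a pair of adjacent columns, and rounding both sides up, leaves a finite
  check over that pair. The same check shows that \<open>\<gamma>\<close> elements no longer suffice after deleting
  the middle vertical edge of column 3 (if \<open>n mod 4 = 3\<close>), or the two outer horizontal edges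
  between columns \<open>k\<close> and \<open>k + 1\<close> for \<open>k = n mod 4 + 3\<close> (otherwise).

  In the second case no single edge is enough: an edge matters for a two-dominating set only if
  it joins a member to a non-member with exactly two neighbours in the set. Two periodic patterns
  of size \<open>\<gamma>\<close> together with their upside-down images have no such edge in common, and
  by periodicity this is a finite check on windows of four columns.\<close>

subsection \<open>Columns of a vertex set\<close>

lemma edges_grid_graph_iff:
  "{p, q} \<in> edges (grid_graph m n) \<longleftrightarrow>
     p \<in> {1..m} \<times> {1..n} \<and> q \<in> {1..m} \<times> {1..n} \<and> grid_adjacent p q"
proof -
  have "grid_adjacent x y \<Longrightarrow> grid_adjacent y x" for x y
    by (auto simp: grid_adjacent_def)
  then show ?thesis
    by (simp add: grid_graph_def doubleton_eq_iff del: split_paired_Ex mem_Sigma_iff) blast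
qed

lemma finite_edges_grid_graph: "finite (edges (grid_graph m n))"
proof (rule finite_subset)
  show "edges (grid_graph m n) \<subseteq> Pow ({1..m} \<times> {1..n})"
    by (auto simp: grid_graph_def)
qed auto

lemma delete_no_edges [simp]: "delete_edges G {} = (G :: 'a ugraph)"
  by (simp add: delete_edges_def)

text \<open>Positions outside the grid are never in \<open>D\<close>, so the truncated index 0 and
  the indices past the border contribute nothing and border vertices need no separate case.\<close>

lemma card_neighbours_grid_graph:
  assumes D: "D \<subseteq> {1..m} \<times> {1..n}" and i: "i \<in> {1..m}" and j: "j \<in> {1..n}"
  shows "card (neighbours (delete_edges (grid_graph m n) B) (i, j) \<inter> D) =
    of_bool ((i, j - 1) \<in> D \<and> {(i, j - 1), (i, j)} \<notin> B) +
    of_bool ((i, j + 1) \<in> D \<and> {(i, j), (i, j + 1)} \<notin> B) +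
    of_bool ((i - 1, j) \<in> D \<and> {(i - 1, j), (i, j)} \<notin> B) +
    of_bool ((i + 1, j) \<in> D \<and> {(i, j), (i + 1, j)} \<notin> B)"
proof -
  let ?S = "{(i, j - 1), (i, j + 1), (i - 1, j), (i + 1, j)}"
  let ?P = "\<lambda>p. p \<in> D \<and> {p, (i, j)} \<notin> B"
  have "(p \<in> neighbours (delete_edges (grid_graph m n) B) (i, j) \<inter> D) = (p \<in> {p \<in> ?S. ?P p})" for p
  proof -
    have "grid_adjacent p (i, j) \<longleftrightarrow> p \<in> ?S" if "p \<in> D"
      using D that i j by (cases p) (auto simp: grid_adjacent_def)
    moreover have "verts (grid_graph m n) = {1..m} \<times> {1..n}"
      by (simp add: grid_graph_def)
    ultimately show ?thesis
      using D i j
      by (auto simp: neighbours_def delete_edges_def edges_grid_graph_iff simp del: insert_iff)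
  qed
  then have "card (neighbours (delete_edges (grid_graph m n) B) (i, j) \<inter> D) = card {p \<in> ?S. ?P p}"
    by (intro arg_cong[where f = card]) blast
  also have "\<dots> = (\<Sum>p\<in>?S. of_bool (?P p))"
    by (subst of_bool_def, subst sum.inter_filter[symmetric]) simp_all
  also have "\<dots> = of_bool (?P (i, j - 1)) + of_bool (?P (i, j + 1)) +
      of_bool (?P (i - 1, j)) + of_bool (?P (i + 1, j))"
  proof -
    have "j - 1 \<noteq> j + 1" "i - 1 \<noteq> i" "j - 1 \<noteq> j"
      using i j by auto
    then show ?thesis
      by simp
  qed
  finally show ?thesis
    by (simp add: insert_commute)
qed

definition column :: "(nat \<times> nat) set \<Rightarrow> nat \<Rightarrow> nat set" where
  "column D j = {i. (i, j) \<in> D}"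

lemma card_eq_sum_column:
  assumes "D \<subseteq> {1..m} \<times> {1..n}"
  shows "card D = (\<Sum>j = 1..n. card (column D j))"
proof -
  have "D = (\<lambda>(j, i). (i, j)) ` Sigma {1..n} (column D)"
    using assms by (auto simp: column_def image_iff)
  then have "card D = card (Sigma {1..n} (column D))"
    by (metis (no_types, lifting) card_image inj_onI case_prod_conv prod.collapse prod.inject)
  moreover have "finite (column D j)" for j
    by (rule finite_subset[of _ "{1..m}"]) (use assms in \<open>auto simp: column_def\<close>)
  ultimately show ?thesis
    by simp
qed

section \<open>Four rows: domination as a condition on three consecutive columns\<close>

abbreviation rows :: "nat set" where "rows \<equiv> {1, 2, 3, 4}"

lemma rows_eq: "{1..4} = rows"
  by auto

text \<open>Here \<open>a\<close>, \<open>b\<close>, \<open>c\<close> are the parts of \<open>D\<close> in three consecutive columns and \<open>X\<close> consists of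
  the rows \<open>i\<close> for which the edge between rows \<open>i\<close> and \<open>i + 1\<close> of the middle column is missing.
  Missing edges to the neighbouring columns are encoded by removing rows from \<open>a\<close> and \<open>c\<close>.\<close>

definition deg :: "nat set \<Rightarrow> nat set \<Rightarrow> nat set \<Rightarrow> nat set \<Rightarrow> nat \<Rightarrow> nat" where
  "deg X a b c i = of_bool (i \<in> a) + of_bool (i \<in> c)
     + of_bool (i - 1 \<in> b \<and> i - 1 \<notin> X) + of_bool (i + 1 \<in> b \<and> i \<notin> X)"

definition dominated :: "nat set \<Rightarrow> nat set \<Rightarrow> nat set \<Rightarrow> nat set \<Rightarrow> bool" where
  "dominated X a b c \<longleftrightarrow> (\<forall>i \<in> rows - b. 2 \<le> deg X a b c i)"

text \<open>Left-right reflection, by which the tail bound also serves the columns left of the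
  split.\<close>

lemma dominated_swap: "dominated X a b c = dominated X c b a"
  by (simp add: dominated_def deg_def add.commute)

definition left_part :: "(nat \<times> nat) set set \<Rightarrow> (nat \<times> nat) set \<Rightarrow> nat \<Rightarrow> nat set" where
  "left_part B D j = {i. (i, j - 1) \<in> D \<and> {(i, j - 1), (i, j)} \<notin> B}"

definition right_part :: "(nat \<times> nat) set set \<Rightarrow> (nat \<times> nat) set \<Rightarrow> nat \<Rightarrow> nat set" where
  "right_part B D j = {i. (i, j + 1) \<in> D \<and> {(i, j), (i, j + 1)} \<notin> B}"

definition missing :: "(nat \<times> nat) set set \<Rightarrow> nat \<Rightarrow> nat set" where
  "missing B j = {i. {(i, j), (i + 1, j)} \<in> B}"

lemma card_neighbours_eq_deg:
  assumes "D \<subseteq> {1..4} \<times> {1..n}" "i \<in> rows" "j \<in> {1..n}"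
  shows "card (neighbours (delete_edges (grid_graph 4 n) B) (i, j) \<inter> D) =
    deg (missing B j) (left_part B D j) (column D j) (right_part B D j) i"
proof -
  have "i - 1 + 1 = i" "i \<in> {1..4}"
    using assms(2) by auto
  then show ?thesis
    by (simp only: card_neighbours_grid_graph[OF assms(1) _ assms(3)] deg_def left_part_def
        right_part_def missing_def column_def mem_Collect_eq)
qed

text \<open>A vertex has neighbours only in its own column and the two adjacent ones, so both bounds
  reduce to sequences of columns.\<close>

lemma two_dominating_grid_iff:
  "two_dominating (delete_edges (grid_graph 4 n) B) D \<longleftrightarrow>
     D \<subseteq> {1..4} \<times> {1..n} \<and>
     (\<forall>j \<in> {1..n}. dominated (missing B j) (left_part B D j) (column D j) (right_part B D j))"
proof -
  have "verts (delete_edges (grid_graph 4 n) B) = {1..4} \<times> {1..n}"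
    by (simp add: delete_edges_def grid_graph_def)
  moreover have "(\<forall>v \<in> {1..4} \<times> {1..n} - D. 2 \<le> card (neighbours (delete_edges (grid_graph 4 n) B) v \<inter> D))
      \<longleftrightarrow> (\<forall>j \<in> {1..n}. dominated (missing B j) (left_part B D j) (column D j) (right_part B D j))"
    if "D \<subseteq> {1..4} \<times> {1..n}"
  proof -
    have "(\<forall>v \<in> {1..4} \<times> {1..n} - D. Q v) \<longleftrightarrow> (\<forall>j \<in> {1..n}. \<forall>i \<in> rows - column D j. Q (i, j))" for Q
      unfolding rows_eq[symmetric] by (auto simp: column_def)
    then show ?thesis
      by (simp add: dominated_def card_neighbours_eq_deg[OF that] del: insert_iff)
  qed
  ultimately show ?thesis
    unfolding two_dominating_def by auto
qed

lemma two_domination_number_le: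
  "two_dominating G D \<Longrightarrow> two_domination_number G \<le> card D"
  unfolding two_domination_number_def by (rule cINF_lower) auto

lemma two_domination_number_ge:
  assumes "\<And>D. two_dominating G D \<Longrightarrow> k \<le> card D"
  shows "k \<le> two_domination_number G"
proof -
  have "two_dominating G (verts G)"
    by (simp add: two_dominating_def)
  then show ?thesis
    unfolding two_domination_number_def by (intro cINF_greatest) (use assms in auto)
qed

subsection \<open>The lower bound\<close>

text \<open>The next column gives each vertex at most one neighbour, so a vertex outside the set
  with none so far is lost.\<close>

definition live :: "nat set \<Rightarrow> nat set \<Rightarrow> nat set \<Rightarrow> bool" where
  "live X a b \<longleftrightarrow> (\<forall>i \<in> rows - b. 1 \<le> deg X a b {} i)"

definition need :: "nat set \<Rightarrow> nat set \<Rightarrow> nat set \<Rightarrow> nat set" where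
  "need X a b = Set.filter (\<lambda>i. i \<notin> b \<and> deg X a b {} i < 2) rows"

lemma dominated_iff: "dominated X a b c \<longleftrightarrow> live X a b \<and> need X a b \<subseteq> c"
proof -
  have "deg X a b c i = deg X a b {} i + of_bool (i \<in> c)" for i
    by (simp add: deg_def)
  then show ?thesis
    by (auto simp: dominated_def live_def need_def split: if_splits) (force simp: of_bool_def split: if_splits)+
qed

text \<open>The value is a lower bound for \<open>4 w - 7 m\<close> (valid for all \<open>m \<ge> 1\<close>), where \<open>w\<close> is the
  least weight of \<open>m\<close> columns completing a pattern whose last column so far is \<open>b\<close>, with the rows
  in \<open>N\<close> waiting for a neighbour on the right. It was found by computing these weights and then
  lowering the exact values to a short formula for which all later bounds are still attained.\<close>

definition potential :: "nat set \<Rightarrow> nat set \<Rightarrow> int" where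
  "potential b N =
     (let k = card b; E = ({1, 2} \<subseteq> N \<or> {3, 4} \<subseteq> N) in
      if k = 0 then 8
      else if k = 1 then (if E then if card N = 2 \<and> b \<subseteq> {1, 4} then 3 else 4 else 2)
      else if k = 2 then (if E then 2 else 1) else - 1)"

text \<open>The second inequality is for the last column: nothing may wait there, and no further
  column pays for the potential of \<open>c\<close>.\<close>

lemma potential_step_check:
  "\<forall>X\<in>{{}, {2}}. \<forall>a\<in>Pow rows. \<forall>b\<in>Pow rows. live X a b \<longrightarrow>
    (let N = need X a b; p = potential b N + 7 in \<forall>c\<in>Pow rows. N \<subseteq> c \<longrightarrow> live {} b c \<longrightarrow>
      (let M = need {} b c; w = 4 * int (card c) in p \<le> w + potential c M \<and> (M = {} \<longrightarrow> p \<le> w)))"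
  by code_simp

lemma potential_step:
  assumes "X \<in> {{}, {2}}" "a \<subseteq> rows" "b \<subseteq> rows" "c \<subseteq> rows"
    and "dominated X a b c" "live {} b c"
  shows "potential b (need X a b) + 7 \<le> 4 * int (card c) + potential c (need {} b c)"
    and "need {} b c = {} \<Longrightarrow> potential b (need X a b) + 7 \<le> 4 * int (card c)"
  using potential_step_check[rule_format, of X a b] assms
  by (auto simp: dominated_iff Let_def)

text \<open>Summing \<open>potential_step\<close> telescopes the potentials. A deletion at the split
  shows only in \<open>X\<close> and \<open>a\<close>, the surroundings of the first column; after
  one step they become \<open>{}\<close> and \<open>c k\<close>, hence the generalisation.\<close>

lemma tail_bound:
  assumes "k < n" and "X \<in> {{}, {2}}" and "a \<subseteq> rows"
    and "\<And>j. c j \<subseteq> rows" and "c (Suc n) = {}"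
    and "dominated X a (c k) (c (Suc k))"
    and "\<And>j. k < j \<Longrightarrow> j \<le> n \<Longrightarrow> dominated {} (c (j - 1)) (c j) (c (Suc j))"
  shows "7 * int (n - k) + potential (c k) (need X a (c k)) \<le> 4 * int (\<Sum>j = Suc k..n. card (c j))"
  using assms
proof (induction "n - k" arbitrary: k X a)
  case 0
  then show ?case by simp
next
  case (Suc d)
  have next_dom: "dominated {} (c k) (c (Suc k)) (c (Suc (Suc k)))"
    using Suc.prems(7)[of "Suc k"] Suc.prems(1) by simp
  then have live: "live {} (c k) (c (Suc k))"
    by (simp add: dominated_iff)
  note step = potential_step[OF Suc.prems(2,3,4,4,6) live]
  show ?case
  proof (cases "Suc k = n")
    case True
    \<comment> \<open>The padding column \<open>Suc n\<close> is empty, so no row can wait after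
      column \<open>n\<close>.\<close>
    then have "need {} (c k) (c (Suc k)) = {}"
      using next_dom Suc.prems(5) by (simp add: dominated_iff)
    then show ?thesis
      using step(2) True by auto
  next
    case False
    have "7 * int (n - Suc k) + potential (c (Suc k)) (need {} (c k) (c (Suc k)))
        \<le> 4 * int (\<Sum>j = Suc (Suc k)..n. card (c j))"
      by (rule Suc.hyps(1)) (use False Suc next_dom in auto)
    then show ?thesis
      using step(1) Suc.prems(1) False
      by (simp add: sum.atLeast_Suc_atMost[of "Suc k" n] of_nat_diff algebra_simps)
  qed
qed

text \<open>The columns \<open>a\<close> and \<open>b\<close> have \<open>l\<close> columns on the left of \<open>a\<close> and \<open>r\<close> (modulo 4) columns on the
  right of \<open>b\<close>; \<open>- (- x) div 4\<close> is the rounded-up quotient. The edges between \<open>a\<close> and \<open>b\<close> in the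
  rows \<open>Z\<close> are missing. Rounding the two sides separately is what makes the bound sharp.\<close>

definition split_at_least :: "nat set \<Rightarrow> nat set \<Rightarrow> nat \<Rightarrow> nat \<Rightarrow> int \<Rightarrow> bool" where
  "split_at_least X Z l r t \<longleftrightarrow>
     (\<forall>a\<in>Pow rows. \<forall>b\<in>Pow rows. live X (b - Z) a \<longrightarrow> live {} (a - Z) b \<longrightarrow>
        t \<le> int (card a) + int (card b)
             - (- (7 * int l + potential a (need X (b - Z) a))) div 4
             - (- (7 * int r + potential b (need {} (a - Z) b))) div 4)"

text \<open>\<open>tail_bound\<close> is applied on both sides of the pair and each weight is
  rounded up. One check covers all \<open>q\<close>, since four more columns on the right add
  exactly 7 and do not disturb the rounding.\<close>

lemma split_bound:
  assumes split: "split_at_least X Z l r t" and X: "X \<in> {{}, {2}}"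
    and l: "0 < l" and r: "0 < r + 4 * q" and n: "n = Suc (Suc l) + (r + 4 * q)"
    and c: "\<And>j. c j \<subseteq> rows" "c 0 = {}" "c (Suc n) = {}"
    and left: "dominated X (c l) (c (Suc l)) (c (Suc (Suc l)) - Z)"
    and right: "dominated {} (c (Suc l) - Z) (c (Suc (Suc l))) (c (Suc (Suc (Suc l))))"
    and other: "\<And>j. 1 \<le> j \<Longrightarrow> j \<le> n \<Longrightarrow> j \<noteq> Suc l \<Longrightarrow> j \<noteq> Suc (Suc l) \<Longrightarrow>
        dominated {} (c (j - 1)) (c j) (c (Suc j))"
  shows "t + 7 * int q \<le> int (\<Sum>j = 1..n. card (c j))"
proof -
  define a b where "a = c (Suc l)" and "b = c (Suc (Suc l))"
  have rows: "a \<subseteq> rows" "b \<subseteq> rows" "a - Z \<subseteq> rows" "b - Z \<subseteq> rows"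
    using c(1)[of "Suc l"] c(1)[of "Suc (Suc l)"] unfolding a_def b_def by blast+
  \<comment> \<open>Columns counted leftwards from \<open>b\<close>: \<open>d 1\<close> is
    \<open>a\<close>, and the empty column 0 of \<open>c\<close> becomes the final padding of
    \<open>d\<close>.\<close>
  define d where "d j = c (Suc (Suc l) - j)" for j
  have d: "d 1 = a" "d (Suc 1) = c l"
    by (simp_all add: d_def a_def)
  have "7 * int (Suc l - 1) + potential (d 1) (need X (b - Z) (d 1))
      \<le> 4 * int (\<Sum>j = Suc 1..Suc l. card (d j))"
  proof (rule tail_bound)
    show "1 < Suc l" "X \<in> {{}, {2}}" "b - Z \<subseteq> rows"
      by (fact | simp add: l)+
    show "d j \<subseteq> rows" "d (Suc (Suc l)) = {}" for j
      using c by (simp_all add: d_def)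
    show "dominated X (b - Z) (d 1) (d (Suc 1))"
      using left unfolding d by (subst dominated_swap) (simp add: a_def b_def)
  next
    fix j assume j: "1 < j" "j \<le> Suc l"
    then have eqs: "Suc (Suc l) - (j - 1) = Suc (Suc (Suc l) - j)" "Suc (Suc l) - Suc j = Suc (Suc l) - j - 1"
      by auto
    have "dominated {} (c (Suc (Suc l) - j - 1)) (c (Suc (Suc l) - j)) (c (Suc (Suc (Suc l) - j)))"
      by (rule other) (use j n in auto)
    then show "dominated {} (d (j - 1)) (d j) (d (Suc j))"
      unfolding d_def eqs by (subst dominated_swap)
  qed
  moreover have "(\<Sum>j = Suc 1..Suc l. card (d j)) = (\<Sum>j = 1..l. card (c j))"
    unfolding d_def
    by (rule sum.reindex_bij_witness[of _ "\<lambda>j. Suc (Suc l) - j" "\<lambda>j. Suc (Suc l) - j"]) auto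
  ultimately have left_weight:
    "7 * int l + potential a (need X (b - Z) a) \<le> 4 * int (\<Sum>j = 1..l. card (c j))"
    unfolding d by simp
  have right_weight: "7 * int (n - Suc (Suc l)) + potential b (need {} (a - Z) b)
      \<le> 4 * int (\<Sum>j = Suc (Suc (Suc l))..n. card (c j))"
    unfolding b_def
  proof (rule tail_bound)
    show "Suc (Suc l) < n" "{} \<in> {{}, {2 :: nat}}"
      using r n by auto
    show "dominated {} (a - Z) (c (Suc (Suc l))) (c (Suc (Suc (Suc l))))"
      using right by (simp add: a_def)
    show "dominated {} (c (j - 1)) (c j) (c (Suc j))" if "Suc (Suc l) < j" "j \<le> n" for j
      using other that by auto
  qed (use c rows in auto)
  have total: "(\<Sum>j = 1..n. card (c j)) =
      (\<Sum>j = 1..l. card (c j)) + card a + card b + (\<Sum>j = Suc (Suc (Suc l))..n. card (c j))"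
    using sum.ub_add_nat[of 1 "Suc (Suc l)" "\<lambda>j. card (c j)" "r + 4 * q"]
    by (simp add: n a_def b_def)
  have "live X (b - Z) a" "live {} (a - Z) b"
    using left[unfolded dominated_swap[of X "c l"]] right
    by (simp_all only: a_def b_def dominated_iff)
  then have "t \<le> int (card a) + int (card b)
      - (- (7 * int l + potential a (need X (b - Z) a))) div 4
      - (- (7 * int r + potential b (need {} (a - Z) b))) div 4"
    using split rows(1,2) unfolding split_at_least_def by blast
  moreover have "- int (\<Sum>j = 1..l. card (c j)) \<le> - (7 * int l + potential a (need X (b - Z) a)) div 4"
    using left_weight by linarith
  moreover have "7 * int q - int (\<Sum>j = Suc (Suc (Suc l))..n. card (c j))
      \<le> - (7 * int r + potential b (need {} (a - Z) b)) div 4"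
  proof -
    have "int (n - Suc (Suc l)) = int r + 4 * int q"
      by (simp add: n)
    then show ?thesis
      using right_weight by linarith
  qed
  ultimately show ?thesis
    unfolding total of_nat_add by linarith
qed

section \<open>Edge deletions in terms of columns\<close>

definition removed_edges :: "nat set \<Rightarrow> nat set \<Rightarrow> nat \<Rightarrow> (nat \<times> nat) set set" where
  "removed_edges X Z k = (\<lambda>i. {(i, k), (i + 1, k)}) ` X \<union> (\<lambda>i. {(i, k), (i, k + 1)}) ` Z"

lemma vertical_edge_eq_iff: "{(i, j), (i + 1, j)} = {(i', k), (i' + 1, k)} \<longleftrightarrow> i = i' \<and> j = k"
  for i j i' k :: nat
  unfolding doubleton_eq_iff by auto

lemma horizontal_edge_eq_iff: "{(i, j), (i, j + 1)} = {(i', k), (i', k + 1)} \<longleftrightarrow> i = i' \<and> j = k"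
  for i j i' k :: nat
  unfolding doubleton_eq_iff by auto

lemma vertical_neq_horizontal: "{(i, j), (i + 1, j)} \<noteq> {(i', k), (i', k + 1)}"
  for i j i' k :: nat
  unfolding doubleton_eq_iff by auto

lemma vertical_edge_in_removed_edges: "{(i, j), (i + 1, j)} \<in> removed_edges X Z k \<longleftrightarrow> i \<in> X \<and> j = k"
  unfolding removed_edges_def Un_iff image_iff vertical_edge_eq_iff using vertical_neq_horizontal by blast

lemma horizontal_edge_in_removed_edges: "{(i, j), (i, j + 1)} \<in> removed_edges X Z k \<longleftrightarrow> i \<in> Z \<and> j = k"
  unfolding removed_edges_def Un_iff image_iff horizontal_edge_eq_iff using vertical_neq_horizontal by metis

lemma missing_removed_edges: "missing (removed_edges X Z k) j = (if j = k then X else {})"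
  unfolding missing_def vertical_edge_in_removed_edges by auto

lemma right_part_removed_edges: "right_part (removed_edges X Z k) D j = column D (j + 1) - (if j = k then Z else {})"
  unfolding right_part_def horizontal_edge_in_removed_edges column_def by auto

lemma left_part_removed_edges:
  assumes "0 < j"
  shows "left_part (removed_edges X Z k) D j = column D (j - 1) - (if j = Suc k then Z else {})"
proof -
  have j: "j = j - 1 + 1"
    using assms by simp
  have "{(i, j - 1), (i, j)} \<in> removed_edges X Z k \<longleftrightarrow> i \<in> Z \<and> j - 1 = k" for i
    by (subst (2) j) (rule horizontal_edge_in_removed_edges)
  then show ?thesis
    using assms unfolding left_part_def column_def by auto
qed

text \<open>The deletion affects only columns \<open>Suc l\<close> and \<open>Suc (Suc l)\<close>,
  the pair at which \<open>split_bound\<close> cuts. Empty \<open>X\<close> and \<open>Z\<close>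
  give the intact grid.\<close>

lemma lower_bound:
  assumes "split_at_least X Z l r t" and "X \<in> {{}, {2}}" and "0 < l" and r: "0 < r + 4 * q"
    and n: "n = Suc (Suc l) + (r + 4 * q)"
  shows "t + 7 * int q \<le> int (two_domination_number (delete_edges (grid_graph 4 n) (removed_edges X Z (Suc l))))"
proof -
  have "nat (t + 7 * int q) \<le> card D"
    if D: "two_dominating (delete_edges (grid_graph 4 n) (removed_edges X Z (Suc l))) D" for D
  proof -
    have sub: "D \<subseteq> {1..4} \<times> {1..n}"
      using D unfolding two_dominating_grid_iff by (rule conjunct1)
    have dom: "dominated (if j = Suc l then X else {})
        (column D (j - 1) - (if j = Suc (Suc l) then Z else {})) (column D j)
        (column D (j + 1) - (if j = Suc l then Z else {}))" if "j \<in> {1..n}" for j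
    proof -
      have "0 < j"
        using that by simp
      moreover have "dominated (missing (removed_edges X Z (Suc l)) j) (left_part (removed_edges X Z (Suc l)) D j)
          (column D j) (right_part (removed_edges X Z (Suc l)) D j)"
        using D that unfolding two_dominating_grid_iff by blast
      ultimately show ?thesis
        by (simp only: missing_removed_edges right_part_removed_edges left_part_removed_edges)
    qed
    have "t + 7 * int q \<le> int (\<Sum>j = 1..n. card (column D j))"
    proof (rule split_bound[OF assms, where c = "column D"])
      show "column D j \<subseteq> rows" for j
        using sub unfolding rows_eq[symmetric] by (auto simp: column_def)
      show "column D 0 = {}" "column D (Suc n) = {}"
        using sub by (auto simp: column_def)
      show "dominated X (column D l) (column D (Suc l)) (column D (Suc (Suc l)) - Z)"
        using dom[of "Suc l"] n by simp
      show "dominated {} (column D (Suc l) - Z) (column D (Suc (Suc l))) (column D (Suc (Suc (Suc l))))"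
        using dom[of "Suc (Suc l)"] n r by simp
      show "dominated {} (column D (j - 1)) (column D j) (column D (Suc j))"
        if "1 \<le> j" "j \<le> n" "j \<noteq> Suc l" "j \<noteq> Suc (Suc l)" for j
        using dom[of j] that by simp
    qed
    then show ?thesis
      unfolding card_eq_sum_column[OF sub] by (simp only: nat_le_iff)
  qed
  from two_domination_number_ge[OF this] show ?thesis
    by (simp add: nat_le_iff)
qed

text \<open>For \<open>n = l + 2 + r + 4 * q\<close>, the number \<open>(7 * n + 6) div 4\<close> is
  \<open>7 * q\<close> plus 8, 10, 12 if \<open>r = 0\<close> and \<open>l = 2, 3, 4\<close>, and
  plus 13 if \<open>l = 2\<close> and \<open>r = 3\<close>. The checks with deleted edges exceed it
  by one.\<close>

lemma split_checks:
  "split_at_least {} {} 2 0 8" "split_at_least {} {} 3 0 10" "split_at_least {} {} 4 0 12"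
  "split_at_least {} {1, 4} 2 0 9" "split_at_least {} {1, 4} 3 0 11" "split_at_least {} {1, 4} 4 0 13"
  "split_at_least {2} {} 2 3 14"
  by code_simp+

subsection \<open>The upper bound\<close>

text \<open>A deleted edge takes a neighbour in \<open>D\<close> only from an end outside
  \<open>D\<close> whose other end is in \<open>D\<close>; out of three such neighbours, two
  remain.\<close>

lemma two_dominating_delete_edge:
  assumes D: "two_dominating G D"
    and p: "p \<in> D \<Longrightarrow> q \<in> D \<or> 3 \<le> card (neighbours G q \<inter> D)"
    and q: "q \<in> D \<Longrightarrow> p \<in> D \<or> 3 \<le> card (neighbours G p \<inter> D)"
  shows "two_dominating (delete_edges G {{p, q}}) D"
proof -
  have "2 \<le> card (neighbours (delete_edges G {{p, q}}) v \<inter> D)" if v: "v \<in> verts G - D" for v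
  proof (cases "\<exists>u \<in> D. {u, v} = {p, q}")
    case True
    then obtain u where u: "{u, v} = {p, q}" "u \<in> D"
      by auto
    then have "3 \<le> card (neighbours G v \<inter> D)"
      using p q v by (auto simp: doubleton_eq_iff)
    moreover have "neighbours (delete_edges G {{p, q}}) v \<inter> D = neighbours G v \<inter> D - {u}"
      using u(1) by (auto simp: neighbours_def delete_edges_def doubleton_eq_iff)
    ultimately show ?thesis
      by (simp only: card_Diff_singleton_if split: if_split) linarith
  next
    case False
    then have "neighbours (delete_edges G {{p, q}}) v \<inter> D = neighbours G v \<inter> D"
      by (auto simp: neighbours_def delete_edges_def)
    then show ?thesis
      using D v by (simp add: two_dominating_def)
  qed
  then show ?thesis
    using D by (simp add: two_dominating_def delete_edges_def)
qed

section \<open>Words, their windows and pumping\<close>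

fun windows :: "('a \<Rightarrow> 'a \<Rightarrow> 'a \<Rightarrow> 'a \<Rightarrow> bool) \<Rightarrow> 'a list \<Rightarrow> bool" where
  "windows Q (a # b # c # d # xs) \<longleftrightarrow> Q a b c d \<and> windows Q (b # c # d # xs)"
| "windows Q _ \<longleftrightarrow> True"

lemma windows_iff_nth:
  "windows Q xs \<longleftrightarrow> (\<forall>k. k + 3 < length xs \<longrightarrow> Q (xs ! k) (xs ! (k + 1)) (xs ! (k + 2)) (xs ! (k + 3)))"
proof (induction Q xs rule: windows.induct)
  case (1 Q a b c d xs)
  have "(\<forall>k. P k) \<longleftrightarrow> P 0 \<and> (\<forall>k. P (Suc k))" for P :: "nat \<Rightarrow> bool"
    by (metis not0_implies_Suc)
  note this[where P = "\<lambda>k. k + 3 < length (a # b # c # d # xs) \<longrightarrow> Q ((a # b # c # d # xs) ! k)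
    ((a # b # c # d # xs) ! (k + 1)) ((a # b # c # d # xs) ! (k + 2)) ((a # b # c # d # xs) ! (k + 3))"]
  then show ?case
    using 1 by (simp add: eval_nat_numeral)
qed auto

text \<open>A window meeting both \<open>u\<close> and \<open>w\<close> would contain all of
  \<open>v\<close> and so at least five letters.\<close>

lemma windows_append:
  assumes "3 \<le> length v"
  shows "windows Q (u @ v @ w) \<longleftrightarrow> windows Q (u @ v) \<and> windows Q (v @ w)"
proof -
  let ?W = "\<lambda>xs k. Q (xs ! k) (xs ! (k + 1)) (xs ! (k + 2)) (xs ! (k + 3))"
  have front: "?W (u @ v @ w) k = ?W (u @ v) k" if "k + 3 < length (u @ v)" for k
    using that by (simp add: append_assoc[symmetric] nth_append del: append_assoc)
  have rear: "?W (u @ v @ w) (length u + k) = ?W (v @ w) k" for k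
    by (simp only: add.assoc nth_append_length_plus)
  show ?thesis
  proof (intro iffI conjI)
    assume "windows Q (u @ v @ w)"
    then have whole: "?W (u @ v @ w) k" if "k + 3 < length (u @ v @ w)" for k
      using that unfolding windows_iff_nth by blast
    have "?W (u @ v) k" if "k + 3 < length (u @ v)" for k
      using whole[of k] front[OF that] that by simp
    then show "windows Q (u @ v)"
      unfolding windows_iff_nth by blast
    have "?W (v @ w) k" if "k + 3 < length (v @ w)" for k
      using whole[of "length u + k"] rear[of k] that by simp
    then show "windows Q (v @ w)"
      unfolding windows_iff_nth by blast
  next
    assume "windows Q (u @ v) \<and> windows Q (v @ w)"
    then have parts: "k + 3 < length (u @ v) \<Longrightarrow> ?W (u @ v) k"
        "k + 3 < length (v @ w) \<Longrightarrow> ?W (v @ w) k" for k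
      unfolding windows_iff_nth by auto
    have "?W (u @ v @ w) k" if "k + 3 < length (u @ v @ w)" for k
    proof (cases "k + 3 < length (u @ v)")
      case True
      then show ?thesis
        using parts(1) front by blast
    next
      case False
      then have k: "length u + (k - length u) = k" "k - length u + 3 < length (v @ w)"
        using assms that by auto
      show ?thesis
        using parts(2)[OF k(2)] unfolding rear[of "k - length u", symmetric] k(1) .
    qed
    then show "windows Q (u @ v @ w)"
      unfolding windows_iff_nth by blast
  qed
qed

text \<open>Words can be glued along \<open>v\<close>, so repetition creates no windows beyond those
  of \<open>v @ s @ v\<close> and of the given word.\<close>

lemma windows_pump:
  assumes "3 \<le> length v" and "windows Q (v @ s @ v)"
  shows "windows Q (u @ v @ w) \<Longrightarrow> windows Q (u @ v @ concat (replicate k (s @ v)) @ w)"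
proof (induction k arbitrary: u)
  case (Suc k)
  have "windows Q (u @ v)" "windows Q (v @ w)"
    using Suc.prems windows_append[OF assms(1)] by auto
  \<comment> \<open>The induction hypothesis is used with \<open>v @ s\<close> in place of
    \<open>u\<close>; the true prefix is glued on afterwards.\<close>
  moreover from this have "windows Q ((v @ s) @ v @ w)"
    using assms windows_append[OF assms(1), of Q "v @ s" w] by simp
  from Suc.IH[OF this] have "windows Q (v @ (s @ v) @ concat (replicate k (s @ v)) @ w)"
    by simp
  ultimately show ?case
    using windows_append[OF assms(1), of Q u "concat (replicate (Suc k) (s @ v)) @ w"] by simp
qed simp

section \<open>Vertex sets read off words\<close>

definition pattern :: "('a \<Rightarrow> nat set) \<Rightarrow> 'a list \<Rightarrow> (nat \<times> nat) set" where
  "pattern f u = {(i, j). j < length u \<and> i \<in> f (u ! j)}"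

lemma column_pattern: "column (pattern f u) j = (if j < length u then f (u ! j) else {})"
  by (auto simp: column_def pattern_def)

lemma card_pattern:
  assumes "\<And>x. x \<in> set u \<Longrightarrow> finite (f x)"
  shows "card (pattern f u) = (\<Sum>x\<leftarrow>u. card (f x))"
proof -
  have "pattern f u = (\<lambda>(j, i). (i, j)) ` (SIGMA j:{..<length u}. f (u ! j))"
    by (auto simp: pattern_def image_iff)
  then have "card (pattern f u) = card (SIGMA j:{..<length u}. f (u ! j))"
    by (metis (no_types, lifting) card_image inj_onI case_prod_conv prod.collapse prod.inject)
  also have "\<dots> = (\<Sum>j<length u. card (f (u ! j)))"
    using assms by simp
  finally show ?thesis
    by (simp add: sum_list_sum_nth atLeast0LessThan)
qed

text \<open>A letter encodes a column in several patterns at once, and \<open>F\<close> lists the functions reading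
  off these patterns. An edge is safe if its deletion is harmless for at least one of them.
  Windows have width four because a horizontal edge is judged from both of its ends.\<close>

definition dominated_window :: "('a \<Rightarrow> nat set) list \<Rightarrow> 'a \<Rightarrow> 'a \<Rightarrow> 'a \<Rightarrow> 'a \<Rightarrow> bool" where
  "dominated_window F a b c d \<longleftrightarrow>
     (\<forall>f \<in> set F. dominated {} (f a) (f b) (f c) \<and> dominated {} (f b) (f c) (f d))"

text \<open>The hypotheses of \<open>two_dominating_delete_edge\<close> for a vertical edge in
  column \<open>b\<close>; \<open>safe_horizontal\<close> has them for an edge between
  \<open>b\<close> and \<open>c\<close>.\<close>

definition safe_vertical :: "nat set \<Rightarrow> nat set \<Rightarrow> nat set \<Rightarrow> nat \<Rightarrow> bool" where
  "safe_vertical a b c i \<longleftrightarrow>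
     (i \<in> b \<longrightarrow> i + 1 \<in> b \<or> 3 \<le> deg {} a b c (i + 1)) \<and>
     (i + 1 \<in> b \<longrightarrow> i \<in> b \<or> 3 \<le> deg {} a b c i)"

definition safe_horizontal :: "nat set \<Rightarrow> nat set \<Rightarrow> nat set \<Rightarrow> nat set \<Rightarrow> nat \<Rightarrow> bool" where
  "safe_horizontal a b c d i \<longleftrightarrow>
     (i \<in> b \<longrightarrow> i \<in> c \<or> 3 \<le> deg {} b c d i) \<and> (i \<in> c \<longrightarrow> i \<in> b \<or> 3 \<le> deg {} a b c i)"

text \<open>The reading \<open>f\<close> may vary with the edge. Vertical edges are tested in both
  middle columns because the last column of the grid is the second letter of no window.\<close>

definition safe_window :: "('a \<Rightarrow> nat set) list \<Rightarrow> 'a \<Rightarrow> 'a \<Rightarrow> 'a \<Rightarrow> 'a \<Rightarrow> bool" where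
  "safe_window F a b c d \<longleftrightarrow>
     (\<forall>i \<in> {1, 2, 3}. (\<exists>f \<in> set F. safe_vertical (f a) (f b) (f c) i) \<and>
                  (\<exists>f \<in> set F. safe_vertical (f b) (f c) (f d) i)) \<and>
     (\<forall>i \<in> rows. \<exists>f \<in> set F. safe_horizontal (f a) (f b) (f c) (f d) i)"

text \<open>Letters count from position 0, columns from 1: the empty letters at \<open>0\<close> and
  \<open>n + 1\<close> keep the pattern inside the grid.\<close>

lemma pattern_subset:
  assumes "length u = n + 2" and "\<And>x. x \<in> set u \<Longrightarrow> f x \<subseteq> rows"
    and "f (u ! 0) = {}" and "f (u ! (n + 1)) = {}"
  shows "pattern f u \<subseteq> {1..4} \<times> {1..n}"
proof -
  have "i \<in> {1..4} \<and> j \<in> {1..n}" if "j < n + 2" "i \<in> f (u ! j)" for i j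
  proof
    show "i \<in> {1..4}"
      unfolding rows_eq using assms(1,2) that by (metis nth_mem subsetD)
    have "j \<noteq> 0" "j \<noteq> n + 1"
      using assms(3,4) that(2) by (metis empty_iff)+
    then show "j \<in> {1..n}"
      using that by auto
  qed
  then show ?thesis
    using assms(1) by (auto simp: pattern_def)
qed

lemma no_removed_edges [simp]:
  "missing {} j = {}" "left_part {} D j = column D (j - 1)" "right_part {} D j = column D (j + 1)"
  by (auto simp: missing_def left_part_def right_part_def column_def)

lemma two_dominating_pattern:
  assumes F: "f \<in> set F" and u: "windows (dominated_window F) u" "length u = n + 2" and n: "2 \<le> n"
    and f: "\<And>x. x \<in> set u \<Longrightarrow> f x \<subseteq> rows" "f (u ! 0) = {}" "f (u ! (n + 1)) = {}"
  shows "two_dominating (grid_graph 4 n) (pattern f u)"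
proof -
  have window: "dominated_window F (u ! k) (u ! (k + 1)) (u ! (k + 2)) (u ! (k + 3))" if "k + 1 < n" for k
    using u that by (auto simp: windows_iff_nth)
  have "dominated {} (f (u ! (j - 1))) (f (u ! j)) (f (u ! (j + 1)))" if j: "j \<in> {1..n}" for j
  \<comment> \<open>Column \<open>n\<close> is taken as the third letter of the last window, every
    other column as a second letter.\<close>
  proof (cases "j = n")
    case True
    then show ?thesis
      using window[of "n - 2"] F n by (auto simp: dominated_window_def numeral_2_eq_2 Suc_diff_Suc numeral_3_eq_3)
  next
    case False
    then show ?thesis
      using window[of "j - 1"] F j by (auto simp: dominated_window_def numeral_2_eq_2)
  qed
  then have "two_dominating (delete_edges (grid_graph 4 n) {}) (pattern f u)"
    unfolding two_dominating_grid_iff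
    using pattern_subset[OF u(2) f] u(2) by (auto simp: column_pattern)
  then show ?thesis
    by simp
qed

lemma edge_grid_graph_cases:
  assumes "e \<in> edges (grid_graph 4 n)"
  obtains (vertical) i j where "e = {(i, j), (i + 1, j)}" "i \<in> {1, 2, 3}" "j \<in> {1..n}"
    | (horizontal) i j where "e = {(i, j), (i, j + 1)}" "i \<in> rows" "1 \<le> j" "j < n"
proof -
  obtain a b c d where e: "e = {(a, b), (c, d)}" "a \<in> {1..4}" "b \<in> {1..n}" "c \<in> {1..4}" "d \<in> {1..n}"
      "grid_adjacent (a, b) (c, d)"
    using assms by (auto simp: grid_graph_def)
  have "\<bar>int a - int c\<bar> + \<bar>int b - int d\<bar> = 1"
    using e(6) by (simp add: grid_adjacent_def)
  then have "c = a + 1 \<and> d = b \<or> a = c + 1 \<and> d = b \<or> d = b + 1 \<and> a = c \<or> b = d + 1 \<and> a = c"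
    by arith
  then consider "c = a + 1" "d = b" | "a = c + 1" "d = b" | "d = b + 1" "a = c" | "b = d + 1" "a = c"
    by blast
  then show ?thesis
  proof cases
    case 1
    show ?thesis
      by (rule vertical[of a b]) (use e 1 in auto)
  next
    case 2
    show ?thesis
      by (rule vertical[of c b]) (use e 2 in auto)
  next
    case 3
    show ?thesis
      by (rule horizontal[of a b]) (use e(1,3,5) e(2)[unfolded rows_eq] 3 in auto)
  next
    case 4
    show ?thesis
      by (rule horizontal[of a d]) (use e(1,3,5) e(2)[unfolded rows_eq] 4 in auto)
  qed
qed

lemma two_dominating_delete_pattern:
  assumes e: "e \<in> edges (grid_graph 4 n)" and u: "windows (dominated_window F) u" "windows (safe_window F) u"
      "length u = n + 2" and n: "2 \<le> n"
    and F: "\<And>f x. f \<in> set F \<Longrightarrow> x \<in> set u \<Longrightarrow> f x \<subseteq> rows"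
      "\<And>f. f \<in> set F \<Longrightarrow> f (u ! 0) = {}" "\<And>f. f \<in> set F \<Longrightarrow> f (u ! (n + 1)) = {}"
  shows "\<exists>f \<in> set F. two_dominating (delete_edges (grid_graph 4 n) {e}) (pattern f u)"
proof -
  have window: "safe_window F (u ! k) (u ! (k + 1)) (u ! (k + 2)) (u ! (k + 3))" if "k + 1 < n" for k
    using u(2) that unfolding windows_iff_nth u(3) by simp
  have degree: "card (neighbours (grid_graph 4 n) (i, j) \<inter> pattern f u) =
      deg {} (f (u ! (j - 1))) (f (u ! j)) (f (u ! (j + 1))) i"
    if f: "f \<in> set F" and i: "i \<in> rows" and j: "j \<in> {1..n}" for f i j
  proof -
    have "pattern f u \<subseteq> {1..4} \<times> {1..n}"
      using pattern_subset[OF u(3) F(1)[OF f] F(2)[OF f] F(3)[OF f]] .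
    moreover have "j - 1 < length u" "j < length u" "j + 1 < length u"
      using j u(3) by auto
    ultimately show ?thesis
      using card_neighbours_eq_deg[OF _ i j, of "pattern f u" "{}"]
      by (simp only: delete_no_edges no_removed_edges column_pattern if_True)
  qed
  have member: "(i, j) \<in> pattern f u \<longleftrightarrow> i \<in> f (u ! j)" if "j < n + 2" for f i j
    using that u(3) by (simp add: pattern_def)
  have dominating: "two_dominating (grid_graph 4 n) (pattern f u)" if "f \<in> set F" for f
    using two_dominating_pattern[OF that u(1,3) n F(1)[OF that] F(2)[OF that] F(3)[OF that]] .
  from e show ?thesis
  proof (cases rule: edge_grid_graph_cases)
    case (vertical i j)
    obtain f where f: "f \<in> set F" "safe_vertical (f (u ! (j - 1))) (f (u ! j)) (f (u ! (j + 1))) i"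
    proof (cases "j = n")
      case True
      then have "j - 1 = n - 2 + 1" "j = n - 2 + 2" "j + 1 = n - 2 + 3" "n - 2 + 1 < n"
        using n by auto
      then show ?thesis
        using window[of "n - 2"] vertical(2) that unfolding safe_window_def by metis
    next
      case False
      then have "j = j - 1 + 1" "j + 1 = j - 1 + 2" "j - 1 + 1 < n"
        using vertical(3) by auto
      then show ?thesis
        using window[of "j - 1"] vertical(2) that unfolding safe_window_def by metis
    qed
    have "two_dominating (delete_edges (grid_graph 4 n) {e}) (pattern f u)"
      unfolding vertical(1)
    proof (rule two_dominating_delete_edge[OF dominating[OF f(1)]])
      have i: "i \<in> rows" "i + 1 \<in> rows" and j: "j < n + 2"
        using vertical(2,3) by auto
      show "(i + 1, j) \<in> pattern f u \<or> 3 \<le> card (neighbours (grid_graph 4 n) (i + 1, j) \<inter> pattern f u)"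
        if "(i, j) \<in> pattern f u"
        using f(2) that
        unfolding safe_vertical_def member[OF j] degree[OF f(1) i(2) vertical(3)] by blast
      show "(i, j) \<in> pattern f u \<or> 3 \<le> card (neighbours (grid_graph 4 n) (i, j) \<inter> pattern f u)"
        if "(i + 1, j) \<in> pattern f u"
        using f(2) that
        unfolding safe_vertical_def member[OF j] degree[OF f(1) i(1) vertical(3)] by blast
    qed
    then show ?thesis
      using f(1) by blast
  next
    case (horizontal i j)
    have "j = j - 1 + 1" "j + 1 = j - 1 + 2" "j + 2 = j - 1 + 3" "j - 1 + 1 < n"
      using horizontal(3,4) by auto
    then obtain f where f: "f \<in> set F"
        "safe_horizontal (f (u ! (j - 1))) (f (u ! j)) (f (u ! (j + 1))) (f (u ! (j + 2))) i"
      using window[of "j - 1"] horizontal(2) unfolding safe_window_def by metis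
    have "two_dominating (delete_edges (grid_graph 4 n) {e}) (pattern f u)"
      unfolding horizontal(1)
    proof (rule two_dominating_delete_edge[OF dominating[OF f(1)]])
      have j: "j \<in> {1..n}" "j + 1 \<in> {1..n}" "j < n + 2" "j + 1 < n + 2"
        using horizontal(3,4) by auto
      have shift: "j + 1 - 1 = j" "j + 1 + 1 = j + 2"
        by simp_all
      show "(i, j + 1) \<in> pattern f u \<or> 3 \<le> card (neighbours (grid_graph 4 n) (i, j + 1) \<inter> pattern f u)"
        if "(i, j) \<in> pattern f u"
        using f(2) that
        unfolding safe_horizontal_def member[OF j(3)] member[OF j(4)]
          degree[OF f(1) horizontal(2) j(2)] shift by blast
      show "(i, j) \<in> pattern f u \<or> 3 \<le> card (neighbours (grid_graph 4 n) (i, j) \<inter> pattern f u)"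
        if "(i, j + 1) \<in> pattern f u"
        using f(2) that
        unfolding safe_horizontal_def member[OF j(3)] member[OF j(4)]
          degree[OF f(1) horizontal(2) j(1)] by blast
    qed
    then show ?thesis
      using f(1) by blast
  qed
qed

section \<open>The concrete words and their finite checks\<close>

type_synonym letter = "nat set \<times> nat set"

definition flip :: "nat set \<Rightarrow> nat set" where
  "flip b = (\<lambda>i. 5 - i) ` b"

text \<open>Two patterns and their upside-down images suffice. The part \<open>loop @ link\<close> has length 8 and
  weight 14 and may be repeated after \<open>start @ link\<close>. The leading empty letter of \<open>start\<close> and a trailing
  one are the padding columns 0 and \<open>n + 1\<close>. The tails are indexed by the number of columns
  of the unrepeated pattern; those in \<open>dominating_tails\<close> only serve the first pattern.\<close>

definition views :: "(letter \<Rightarrow> nat set) list" where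
  "views = [fst, snd, flip \<circ> fst, flip \<circ> snd]"

definition start :: "letter list" where
  "start = ({}, {}) # zip [{1, 3}, {2, 4}, {2}] [{1, 3}, {2, 4}, {1, 4}]"

definition link :: "letter list" where
  "link = zip [{1, 3, 4}, {2}, {1, 4}] [{3}, {1, 2, 4}, {3}]"

definition loop :: "letter list" where
  "loop = zip [{3}, {1, 2, 4}, {3}, {1, 4}, {2}] [{1, 4}, {2}, {1, 3, 4}, {2}, {1, 4}]"

definition tails :: "(nat \<times> letter list) list" where
  "tails = [
    (8, zip [{1, 3}, {2, 4}] [{1, 3}, {2, 4}]),
    (9, zip [{1, 3}, {2, 4}, {1, 3}] [{1, 3}, {2, 4}, {1, 3}]),
    (10, zip [{2, 3}, {1, 3}, {2, 4}, {1, 3}] [{1, 3}, {2, 4}, {1, 3}, {2, 4}]),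
    (12, zip [{3}, {1, 2, 4}, {3}, {1, 3}, {2, 4}, {1, 3}]
             [{1, 4}, {2}, {1, 3, 4}, {2}, {1, 4}, {2, 3}]),
    (13, zip [{3}, {1, 2, 4}, {3}, {1, 3}, {2, 4}, {1, 3}, {2, 4}]
             [{1, 4}, {2}, {1, 3, 4}, {2}, {1, 4}, {1, 3}, {2, 4}]),
    (14, zip [{3}, {1, 2, 4}, {3}, {1, 4}, {2, 3}, {1, 3}, {2, 4}, {1, 3}]
             [{1, 4}, {2}, {1, 3, 4}, {2}, {1, 4}, {1, 3}, {2, 4}, {1, 3}])]"

definition dominating_tails :: "(nat \<times> letter list) list" where
  "dominating_tails = [(7, [({1, 3}, {})]), (11, map (\<lambda>b. (b, {})) [{3}, {1, 2, 4}, {3}, {1, 3}, {2, 4}])]"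

text \<open>The 6 counts the three columns of \<open>start\<close> after its padding and the three
  of \<open>link\<close>.\<close>

definition admissible :: "(letter \<Rightarrow> nat set) list \<Rightarrow> nat \<times> letter list \<Rightarrow> bool" where
  "admissible F = (\<lambda>(m, t). length t + 6 = m \<and>
     windows (dominated_window F) (start @ link @ t @ [({}, {})]) \<and>
     (\<forall>f \<in> set F. (\<Sum>x\<leftarrow>start @ link @ t. card (f x)) = (7 * m + 6) div 4 \<and>
        (\<forall>x \<in> set t. f x \<subseteq> rows)))"

text \<open>Together the indices are 7 to 14, one for each residue modulo 8, the length of the
  repeated part; 7 and 11 are those congruent to 3 modulo 4.\<close>

lemma tail_lengths: "fst ` set tails = {8, 9, 10, 12, 13, 14}" "fst ` set dominating_tails = {7, 11}"
  unfolding tails_def dominating_tails_def by simp_all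

lemma windows_dominated_mono:
  "windows (dominated_window G) u \<Longrightarrow> set F \<subseteq> set G \<Longrightarrow> windows (dominated_window F) u"
  unfolding windows_iff_nth dominated_window_def by blast

lemma admissible_mono: "admissible G p \<Longrightarrow> set F \<subseteq> set G \<Longrightarrow> admissible F p"
  unfolding admissible_def case_prod_unfold using windows_dominated_mono by blast

text \<open>By \<open>windows_pump\<close> with \<open>link\<close> as the overlap, this single word
  accounts for any number of repetitions; likewise in \<open>loop_safe\<close>.\<close>

lemma loop_dominated: "windows (dominated_window views) (link @ loop @ link)"
  by code_simp

lemma loop_safe: "windows (safe_window views) (link @ loop @ link)"
  by code_simp

lemma tails_admissible: "\<forall>p \<in> set tails. admissible views p"
  by code_simp

lemma tails_safe: "\<forall>(m, t) \<in> set tails. windows (safe_window views) (start @ link @ t @ [({}, {})])"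
  by code_simp

lemma dominating_tails_admissible: "\<forall>p \<in> set dominating_tails. admissible [fst] p"
  by code_simp

definition word :: "nat \<Rightarrow> letter list \<Rightarrow> letter list" where
  "word q t = start @ link @ concat (replicate q (loop @ link)) @ t @ [({}, {})]"

text \<open>Eight more columns raise \<open>(7 * n + 6) div 4\<close> by exactly 14.\<close>

lemma loop_weight: "\<forall>f \<in> set views. (\<Sum>x\<leftarrow>loop @ link. card (f x)) = 14"
  by code_simp

lemma letters_in_rows: "\<forall>f \<in> set views. \<forall>x \<in> set (start @ link @ loop). f x \<subseteq> rows"
  by code_simp

lemma word_properties:
  assumes F: "set F \<subseteq> set views" and t: "admissible F (m, t)" and n: "n = m + 8 * q"
  shows "windows (dominated_window F) (word q t)" and "length (word q t) = n + 2"
    and "f \<in> set F \<Longrightarrow> x \<in> set (word q t) \<Longrightarrow> f x \<subseteq> rows"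
    and "f \<in> set F \<Longrightarrow> f (word q t ! 0) = {}"
    and "f \<in> set F \<Longrightarrow> f (word q t ! (n + 1)) = {}"
    and "f \<in> set F \<Longrightarrow> card (pattern f (word q t)) = (7 * n + 6) div 4"
proof -
  have "windows (dominated_window F) (link @ loop @ link)"
    using loop_dominated F by (rule windows_dominated_mono)
  then show "windows (dominated_window F) (word q t)"
    unfolding word_def using t by (intro windows_pump) (simp_all add: admissible_def link_def)
  have lengths: "length start = 4" "length link = 3" "length loop = 5"
    by (simp_all add: start_def link_def loop_def)
  have m: "m = length t + 6"
    using t by (simp add: admissible_def)
  have "length (concat (replicate q (loop @ link))) = 8 * q"
    by (induction q) (simp_all add: lengths)
  then show len: "length (word q t) = n + 2"
    by (simp add: word_def lengths n m)
  show sub: "f x \<subseteq> rows" if f: "f \<in> set F" and x: "x \<in> set (word q t)" for f x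
  proof -
    have "set (concat (replicate q (loop @ link))) \<subseteq> set (loop @ link)"
      by (induction q) auto
    then consider "x \<in> set (start @ link @ loop)" | "x \<in> set t" | "x = ({}, {})"
      using x unfolding word_def by fastforce
    then show ?thesis
    proof cases
      case 3
      then show ?thesis
        using f F by (auto simp: views_def flip_def)
    qed (use f F t letters_in_rows in \<open>auto simp: admissible_def\<close>)
  qed
  have empty: "f ({}, {}) = {}" if "f \<in> set F" for f
    using that F by (auto simp: views_def flip_def)
  show "f (word q t ! 0) = {}" if "f \<in> set F"
    using empty[OF that] by (simp add: word_def start_def)
  have "word q t ! (n + 1) = last (word q t)"
    using len by (metis Suc_eq_plus1 add_2_eq_Suc' diff_Suc_1 last_conv_nth length_0_conv nat.distinct(1))
  then show "f (word q t ! (n + 1)) = {}" if "f \<in> set F"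
    using empty[OF that] by (simp add: word_def)
  show "card (pattern f (word q t)) = (7 * n + 6) div 4" if f: "f \<in> set F"
  proof -
    have "card (pattern f (word q t)) = (\<Sum>x\<leftarrow>word q t. card (f x))"
      using sub[OF f] by (intro card_pattern) (meson finite.intros finite_subset)
    also have "\<dots> = (\<Sum>x\<leftarrow>start @ link @ t. card (f x)) + (\<Sum>x\<leftarrow>concat (replicate q (loop @ link)). card (f x))"
      using empty[OF f] by (simp add: word_def)
    also have "(\<Sum>x\<leftarrow>concat (replicate q (loop @ link)). card (f x)) = q * 14"
      using loop_weight F f by (induction q) auto
    also have "(\<Sum>x\<leftarrow>start @ link @ t. card (f x)) = (7 * m + 6) div 4"
      using t f by (simp add: admissible_def)
    finally show ?thesis
      by (simp add: n)
  qed
qed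

section \<open>Bounds on the domination number\<close>

lemma domination_number_delete_edge_le:
  assumes "7 \<le> n" "n mod 4 \<noteq> 3" and e: "e \<in> edges (grid_graph 4 n)"
  shows "two_domination_number (delete_edges (grid_graph 4 n) {e}) \<le> (7 * n + 6) div 4"
proof -
  \<comment> \<open>\<open>m\<close> is the number from 7 to 14 congruent to \<open>n\<close> modulo
    8, and \<open>q\<close> counts the repetitions.\<close>
  define m q where "m = 7 + (n - 7) mod 8" and "q = (n - 7) div 8"
  have n: "n = m + 8 * q"
    using assms(1) by (simp add: m_def q_def)
  have "(n - 7) mod 8 < 8"
    by simp
  then have "m \<in> {7..14}"
    by (simp add: m_def)
  then have "m \<in> {7, 8, 9, 10, 11, 12, 13, 14}"
    by (auto simp: le_Suc_eq numeral_eq_Suc)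
  \<comment> \<open>As 4 divides 8, \<open>m\<close> has the residue of \<open>n\<close> modulo 4,
    so 7 and 11 drop out.\<close>
  moreover have "m mod 4 \<noteq> 3"
    using assms(2) unfolding n by presburger
  ultimately have "m \<in> {8, 9, 10, 12, 13, 14}"
    by (elim insertE) auto
  then have "m \<in> fst ` set tails"
    unfolding tail_lengths .
  then obtain t where t: "(m, t) \<in> set tails"
    by force
  have adm: "admissible views (m, t)"
    using t tails_admissible by blast
  note word = word_properties[OF order_refl adm n]
  have safe: "windows (safe_window views) (word q t)"
    unfolding word_def using t tails_safe loop_safe by (intro windows_pump) (auto simp: link_def)
  have "2 \<le> n"
    using assms(1) by simp
  then have "\<exists>f \<in> set views. two_dominating (delete_edges (grid_graph 4 n) {e}) (pattern f (word q t))"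
    by (rule two_dominating_delete_pattern[OF e word(1) safe word(2)]) (rule word(3-5); assumption)+
  then show ?thesis
    using two_domination_number_le word(6) by metis
qed

text \<open>For the intact grid the reading \<open>fst\<close> alone suffices, so the tails for 7
  and 11 are available too.\<close>

lemma domination_number_le:
  assumes "7 \<le> n"
  shows "two_domination_number (grid_graph 4 n) \<le> (7 * n + 6) div 4"
proof -
  define m q where "m = 7 + (n - 7) mod 8" and "q = (n - 7) div 8"
  have n: "n = m + 8 * q"
    using assms(1) by (simp add: m_def q_def)
  have "(n - 7) mod 8 < 8"
    by simp
  then have "m \<in> {7..14}"
    by (simp add: m_def)
  then have "m \<in> {7, 8, 9, 10, 11, 12, 13, 14}"
    by (auto simp: le_Suc_eq numeral_eq_Suc)
  then have "m \<in> fst ` set tails \<union> fst ` set dominating_tails"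
    unfolding tail_lengths by blast
  then obtain t where t: "(m, t) \<in> set tails \<union> set dominating_tails"
    by force
  have views: "set [fst] \<subseteq> set views"
    by (simp add: views_def)
  have "admissible [fst] (m, t)"
    using t tails_admissible dominating_tails_admissible admissible_mono[OF _ views] by blast
  note word = word_properties[OF views this n]
  have fst: "fst \<in> set [fst]"
    by simp
  have "two_dominating (grid_graph 4 n) (pattern fst (word q t))"
    using two_dominating_pattern[OF fst word(1,2) _ word(3)[OF fst] word(4)[OF fst] word(5)[OF fst]] assms(1)
    by simp
  then show ?thesis
    using two_domination_number_le word(6)[OF fst] by metis
qed

lemma removed_edges_empty [simp]: "removed_edges {} {} k = {}"
  by (simp add: removed_edges_def)

lemma domination_number_lower_bounds:
  assumes "7 \<le> n" "n mod 4 \<noteq> 3"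
  shows "(7 * n + 6) div 4 \<le> two_domination_number (grid_graph 4 n)"
    and "(7 * n + 6) div 4 < two_domination_number (delete_edges (grid_graph 4 n) (removed_edges {} {1, 4} (n mod 4 + 3)))"
proof -
  \<comment> \<open>With \<open>l = n mod 4 + 2\<close> and \<open>r = 0\<close> the cut is at
    column \<open>n mod 4 + 3\<close>; \<open>q\<close> is positive since \<open>n\<close> is at
    least 8.\<close>
  define q where "q = n div 4 - 1"
  have "0 < q"
    using assms unfolding q_def by presburger
  moreover have "n = n mod 4 + 4 + 4 * q"
    using assms unfolding q_def by presburger
  note q = calculation this
  consider "n mod 4 = 0" | "n mod 4 = 1" | "n mod 4 = 2"
    using assms(2) by linarith
  then have "(7 * n + 6) div 4 \<le> two_domination_number (grid_graph 4 n) \<and>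
    (7 * n + 6) div 4 < two_domination_number (delete_edges (grid_graph 4 n) (removed_edges {} {1, 4} (n mod 4 + 3)))"
  proof cases
    case 1
    then show ?thesis
      using lower_bound[OF split_checks(1), of q n] lower_bound[OF split_checks(4), of q n] q
      by (intro conjI; simp; linarith)
  next
    case 2
    then show ?thesis
      using lower_bound[OF split_checks(2), of q n] lower_bound[OF split_checks(5), of q n] q
      by (intro conjI; simp; linarith)
  next
    case 3
    then show ?thesis
      using lower_bound[OF split_checks(3), of q n] lower_bound[OF split_checks(6), of q n] q by simp
  qed
  then show "(7 * n + 6) div 4 \<le> two_domination_number (grid_graph 4 n)"
    "(7 * n + 6) div 4 < two_domination_number (delete_edges (grid_graph 4 n) (removed_edges {} {1, 4} (n mod 4 + 3)))"
    by simp_all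
qed

lemma domination_number_lower_bound_3:
  assumes "7 \<le> n" "n mod 4 = 3"
  shows "(7 * n + 6) div 4 < two_domination_number (delete_edges (grid_graph 4 n) (removed_edges {2} {} 3))"
proof -
  define q where "q = n div 4 - 1"
  have "n = 7 + 4 * q"
    using assms unfolding q_def by presburger
  then show ?thesis
    using lower_bound[OF split_checks(7), of q n] by simp
qed

section \<open>The bondage number\<close>

lemma removed_edges_subset:
  assumes "X \<subseteq> {1..3}" "Z \<subseteq> {1..4}" "k \<in> {1..<n}"
  shows "removed_edges X Z k \<subseteq> edges (grid_graph 4 n)"
proof -
  have "{(i, k), (i + 1, k)} \<in> edges (grid_graph 4 n)" if "i \<in> X" for i
    unfolding edges_grid_graph_iff using assms that by (auto simp: grid_adjacent_def)
  moreover have "{(i, k), (i, k + 1)} \<in> edges (grid_graph 4 n)" if "i \<in> Z" for i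
    unfolding edges_grid_graph_iff using assms that by (auto simp: grid_adjacent_def)
  ultimately show ?thesis
    unfolding removed_edges_def by blast
qed

lemma two_bondage_number_eqI:
  assumes "B \<subseteq> edges G" "two_domination_number G < two_domination_number (delete_edges G B)" "card B \<le> k"
    and "\<And>B. B \<subseteq> edges G \<Longrightarrow> card B < k \<Longrightarrow>
      two_domination_number (delete_edges G B) \<le> two_domination_number G"
  shows "two_bondage_number G = enat k"
proof (rule antisym)
  show "two_bondage_number G \<le> enat k"
    unfolding two_bondage_number_def using assms(1-3) by (intro INF_lower2[of B]) auto
  show "enat k \<le> two_bondage_number G"
    unfolding two_bondage_number_def
  proof (rule INF_greatest)
    fix B assume "B \<in> {B. B \<subseteq> edges G \<and> two_domination_number G < two_domination_number (delete_edges G B)}"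
    then show "enat k \<le> enat (card B)"
      using assms(4)[of B] by (simp add: not_less[symmetric]) (meson not_le)
  qed
qed

theorem theorem5:
  fixes n :: nat
  assumes "n \<ge> 7"
  shows "two_bondage_number (grid_graph 4 n) = (if n mod 4 = 3 then 1 else 2)"
proof (cases "n mod 4 = 3")
  case True
  have "two_bondage_number (grid_graph 4 n) = enat 1"
  proof (rule two_bondage_number_eqI)
    show "removed_edges {2} {} 3 \<subseteq> edges (grid_graph 4 n)"
      by (rule removed_edges_subset) (use assms in auto)
    show "two_domination_number (grid_graph 4 n) < two_domination_number (delete_edges (grid_graph 4 n) (removed_edges {2} {} 3))"
      using domination_number_le[OF assms] domination_number_lower_bound_3[OF assms True] by linarith
    show "card (removed_edges {2} {} 3) \<le> 1"
      by (simp add: removed_edges_def)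
    show "two_domination_number (delete_edges (grid_graph 4 n) B) \<le> two_domination_number (grid_graph 4 n)"
      if "B \<subseteq> edges (grid_graph 4 n)" "card B < 1" for B
    proof -
      have "B = {}"
        using that finite_edges_grid_graph[of 4 n] by (metis card_0_eq finite_subset less_one)
      then show ?thesis
        by simp
    qed
  qed
  then show ?thesis
    using True by (simp add: one_enat_def)
next
  case False
  let ?B = "removed_edges {} {1, 4} (n mod 4 + 3)"
  have r: "n mod 4 < 3"
    using False mod_less_divisor[of 4 n] by linarith
  have "two_bondage_number (grid_graph 4 n) = enat 2"
  proof (rule two_bondage_number_eqI)
    show "?B \<subseteq> edges (grid_graph 4 n)"
      by (rule removed_edges_subset) (use assms r in auto)
    show "two_domination_number (grid_graph 4 n) < two_domination_number (delete_edges (grid_graph 4 n) ?B)"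
      using domination_number_le[OF assms] domination_number_lower_bounds(2)[OF assms False] by linarith
    show "card ?B \<le> 2"
      unfolding removed_edges_def by (simp add: card_insert_if)
    show "two_domination_number (delete_edges (grid_graph 4 n) B) \<le> two_domination_number (grid_graph 4 n)"
      if B: "B \<subseteq> edges (grid_graph 4 n)" "card B < 2" for B
    proof -
      \<comment> \<open>An infinite set would have \<open>card\<close> 0, so finiteness comes
        first.\<close>
      have "finite B"
        using B(1) finite_edges_grid_graph finite_subset by blast
      then consider "B = {}" | e where "B = {e}"
        using B(2) by (metis One_nat_def card_0_eq card_1_singletonE less_2_cases)
      then show ?thesis
      proof cases
        \<comment> \<open>Both sides are compared with \<open>(7 * n + 6) div 4\<close>: an upper
          bound after the deletion, a lower bound before it.\<close>
        case 2
        then show ?thesis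
          using B(1) domination_number_delete_edge_le[OF assms False, of e]
            domination_number_lower_bounds(1)[OF assms False] by simp
      qed simp
    qed
  qed
  then show ?thesis
    using False by (simp add: numeral_eq_enat)
qed

end
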